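(* Let $\Omega,\mathbb{K},g,\mathcal{L},\mathcal{M},z[\cdot,\cdot,\cdot]$ be a dynamic zero-sum game as described in the context, with payoffs $v_T$, $w_\lambda$ and lower value functions $\mathcal{V}_T$, $\mathcal{W}_\lambda$. Assume that the payoff families $v_T$ $(T>0)$ and $w_\lambda$ $(\lambda>0)$ both enjoy the Dynamic Programming Principle. Then the following two statements are equivalent: (i) The family of functions $\mathcal{V}_T$ $(T>0)$ converges uniformly on $\Omega$ as $T\uparrow\infty$. (ii) The family of functions $\mathcal{W}_\lambda$ $(\lambda>0)$ converges uniformly on $\Omega$ as $\lambda\downarrow 0$. Moreover, when at least one of these statements holds, we have $$\lim_{T\uparrow\infty}\mathcal{V}_T(\omega)=\lim_{\lambda\downarrow 0}\mathcal{W}_\lambda(\omega)\qquad\forall\omega\in\Omega.$$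
   Context: Setting: $\mathbb{R}_+=[0,\infty)$. $\Omega$ is a nonempty set (state space); $\mathbb{K}$ is a nonempty set of maps from $\mathbb{R}_+$ to $\Omega$ (processes); $g:\Omega\to[0,1]$ is a running cost such that for every $z\in\mathbb{K}$ the map $t\mapsto g(z(t))$ is Borel measurable. Payoffs: for $T,\lambda>0$ and $z\in\mathbb{K}$, $$v_T(z)=\frac1T\int_0^T g(z(t))\,dt,\qquad w_\lambda(z)=\lambda\int_0^\infty e^{-\lambda t}g(z(t))\,dt .$$ Lower game: for every $\omega\in\Omega$ there are given nonempty sets $\mathcal{L}(\omega)$ and $\mathcal{M}(\omega)$, and each pair $(l,m)\in\mathcal{L}(\omega)\times\mathcal{M}(\omega)$ generates a unique process $z[\omega,l,m]\in\mathbb{K}$ with $z[\omega,l,m](0)=\omega$. For a bounded payoff $c:\mathbb{K}\to\mathbb{R}$ its value function is $$\mathbb{V}[c](\omega)=\sup_{l\in\mathcal{L}(\omega)}\ \inf_{m\in\mathcal{M}(\omega)}c(z[\omega,l,m]),\qquad \omega\in\Omega .$$ Put $\mathcal{V}_T=\mathbb{V}[v_T]$ and $\mathcal{W}_\lambda=\mathbb{V}[w_\lambda]$. Dynamic Programming Principle (DPP): The family $v_T$ $(T>0)$ enjoys the DPP iff for all $T>0$ and all $h\in(0,T)$, $\mathcal{V}_T=\mathbb{V}[c]$ for the payoff $$c(z)=\frac1T\int_0^h g(z(t))\,dt+\frac{T-h}{T}\,\mathcal{V}_{T-h}(z(h)),\qquad z\in\mathbb{K}.$$ The family $w_\lambda$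 $(\lambda>0)$ enjoys the DPP iff for all $\lambda>0$ and all $h>0$, $\mathcal{W}_\lambda=\mathbb{V}[c]$ for the payoff $$c(z)=\lambda\int_0^h e^{-\lambda t}g(z(t))\,dt+e^{-\lambda h}\,\mathcal{W}_\lambda(z(h)),\qquad z\in\mathbb{K}.$$ *)

theory Defs
  imports "HOL-Analysis.Analysis"
begin

(* Maps from [0,\<infinity>) to \<Omega> are extensional functions on {0..}.  Since proc is a function, each
   initial state \<omega> and each pair (l, m) of L \<omega> \<times> M \<omega> generate exactly one process. *)
locale dynamic_game =
  fixes \<Omega> :: "'w set"
    and K :: "(real \<Rightarrow> 'w) set"
    and g :: "'w \<Rightarrow> real"
    and L :: "'w \<Rightarrow> 'l set"
    and M :: "'w \<Rightarrow> 'm set"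
    and proc :: "'w \<Rightarrow> 'l \<Rightarrow> 'm \<Rightarrow> real \<Rightarrow> 'w"
  assumes states_nonempty: "\<Omega> \<noteq> {}"
    and processes_nonempty: "K \<noteq> {}"
    and processes: "K \<subseteq> ({0..} \<rightarrow>\<^sub>E \<Omega>)"
    and running_cost: "g \<in> \<Omega> \<rightarrow> {0..1}"
    and running_cost_measurable:
      "\<And>z. z \<in> K \<Longrightarrow> (\<lambda>t. g (z t)) \<in> borel_measurable (restrict_space borel {0..})"
    and L_nonempty: "\<And>\<omega>. \<omega> \<in> \<Omega> \<Longrightarrow> L \<omega> \<noteq> {}"
    and M_nonempty: "\<And>\<omega>. \<omega> \<in> \<Omega> \<Longrightarrow> M \<omega> \<noteq> {}"
    and proc_in_processes:
      "\<And>\<omega> l m. \<omega> \<in> \<Omega> \<Longrightarrow> l \<in> L \<omega> \<Longrightarrow> m \<in> M \<omega> \<Longrightarrow> proc \<omega> l m \<in> K"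
    and proc_initial:
      "\<And>\<omega> l m. \<omega> \<in> \<Omega> \<Longrightarrow> l \<in> L \<omega> \<Longrightarrow> m \<in> M \<omega> \<Longrightarrow> proc \<omega> l m 0 = \<omega>"

definition cesaro_payoff :: "('w \<Rightarrow> real) \<Rightarrow> real \<Rightarrow> (real \<Rightarrow> 'w) \<Rightarrow> real" where
  "cesaro_payoff g T z = 1 / T * (LINT t:{0..T}|lborel. g (z t))"

definition abel_payoff :: "('w \<Rightarrow> real) \<Rightarrow> real \<Rightarrow> (real \<Rightarrow> 'w) \<Rightarrow> real" where
  "abel_payoff g r z = r * (LINT t:{0..}|lborel. exp (- r * t) * g (z t))"

(* SUP and INF are those of the conditionally complete order on the reals: they are the intended
   ones only for nonempty L \<omega>, M \<omega> and payoffs c bounded on the generated processes. *)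
definition lower_value ::
  "('w \<Rightarrow> 'l set) \<Rightarrow> ('w \<Rightarrow> 'm set) \<Rightarrow> ('w \<Rightarrow> 'l \<Rightarrow> 'm \<Rightarrow> real \<Rightarrow> 'w) \<Rightarrow>
    ((real \<Rightarrow> 'w) \<Rightarrow> real) \<Rightarrow> 'w \<Rightarrow> real" where
  "lower_value L M proc c \<omega> = (SUP l\<in>L \<omega>. INF m\<in>M \<omega>. c (proc \<omega> l m))"

definition cesaro_value ::
  "('w \<Rightarrow> real) \<Rightarrow> ('w \<Rightarrow> 'l set) \<Rightarrow> ('w \<Rightarrow> 'm set) \<Rightarrow> ('w \<Rightarrow> 'l \<Rightarrow> 'm \<Rightarrow> real \<Rightarrow> 'w) \<Rightarrow>
    real \<Rightarrow> 'w \<Rightarrow> real" where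
  "cesaro_value g L M proc T = lower_value L M proc (cesaro_payoff g T)"

definition abel_value ::
  "('w \<Rightarrow> real) \<Rightarrow> ('w \<Rightarrow> 'l set) \<Rightarrow> ('w \<Rightarrow> 'm set) \<Rightarrow> ('w \<Rightarrow> 'l \<Rightarrow> 'm \<Rightarrow> real \<Rightarrow> 'w) \<Rightarrow>
    real \<Rightarrow> 'w \<Rightarrow> real" where
  "abel_value g L M proc r = lower_value L M proc (abel_payoff g r)"

definition cesaro_DPP ::
  "'w set \<Rightarrow> ('w \<Rightarrow> real) \<Rightarrow> ('w \<Rightarrow> 'l set) \<Rightarrow> ('w \<Rightarrow> 'm set) \<Rightarrow>
    ('w \<Rightarrow> 'l \<Rightarrow> 'm \<Rightarrow> real \<Rightarrow> 'w) \<Rightarrow> bool" where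
  "cesaro_DPP \<Omega> g L M proc \<longleftrightarrow>
    (\<forall>T>0. \<forall>h\<in>{0<..<T}. \<forall>\<omega>\<in>\<Omega>.
      cesaro_value g L M proc T \<omega> =
        lower_value L M proc
          (\<lambda>z. 1 / T * (LINT t:{0..h}|lborel. g (z t))
               + (T - h) / T * cesaro_value g L M proc (T - h) (z h)) \<omega>)"

definition abel_DPP ::
  "'w set \<Rightarrow> ('w \<Rightarrow> real) \<Rightarrow> ('w \<Rightarrow> 'l set) \<Rightarrow> ('w \<Rightarrow> 'm set) \<Rightarrow>
    ('w \<Rightarrow> 'l \<Rightarrow> 'm \<Rightarrow> real \<Rightarrow> 'w) \<Rightarrow> bool" where
  "abel_DPP \<Omega> g L M proc \<longleftrightarrow>
    (\<forall>r>0. \<forall>h>0. \<forall>\<omega>\<in>\<Omega>.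
      abel_value g L M proc r \<omega> =
        lower_value L M proc
          (\<lambda>z. r * (LINT t:{0..h}|lborel. exp (- r * t) * g (z t))
               + exp (- r * h) * abel_value g L M proc r (z h)) \<omega>)"

end

theory Submission
  imports Defs
begin

text \<open>
  Put \<open>r = 1 / T\<close> and play the dynamic programming principle over a block of length \<open>\<delta> T\<close>, a fixed
  small fraction of the horizon. Both values then satisfy the same equation
  \<open>A\<^sub>T \<approx> \<V>[1 / T \<integral>\<^sub>0\<^sup>\<delta>\<^sup>T g(z(t)) dt + (1 - \<delta>) A\<^sub>S(z(\<delta> T))]\<close> up to \<open>\<delta>\<^sup>2\<close>, with \<open>S = (1 - \<delta>) T\<close> for
  the Cesaro value and \<open>S = T\<close> for the Abel value. If one of them converges uniformly, the
  mismatch between the two choices of \<open>S\<close> costs at most another \<open>\<delta>\<^sup>2\<close>, so since the value operator is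
  nonexpansive, an eventual bound \<open>b\<close> on the distance of the two values improves to
  \<open>(1 - \<delta>) b + 3 \<delta>\<^sup>2\<close>. The infimum of such bounds is thus at most \<open>3 \<delta>\<close>, for every \<open>\<delta>\<close>.
\<close>

context dynamic_game
begin

section \<open>The sup-inf operator: bounds, monotonicity, nonexpansiveness\<close>

lemma process_state: "z \<in> K \<Longrightarrow> t \<ge> 0 \<Longrightarrow> z t \<in> \<Omega>"
  using processes by (auto simp: PiE_iff)

lemma running_cost_bounds:
  assumes "z \<in> K" "t \<ge> 0"
  shows "0 \<le> g (z t)" "g (z t) \<le> 1"
  using process_state[OF assms] running_cost by (auto simp: Pi_iff)

lemma lower_value_bounds:
  assumes "\<omega> \<in> \<Omega>" and c: "\<And>z. z \<in> K \<Longrightarrow> a \<le> c z \<and> c z \<le> b"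
  shows "a \<le> lower_value L M proc c \<omega>" "lower_value L M proc c \<omega> \<le> b"
proof -
  have P: "proc \<omega> l m \<in> K" if "l \<in> L \<omega>" "m \<in> M \<omega>" for l m
    using proc_in_processes assms(1) that by blast
  obtain l0 m0 where l0: "l0 \<in> L \<omega>" and m0: "m0 \<in> M \<omega>"
    using L_nonempty M_nonempty assms(1) by blast
  have low: "a \<le> (INF m\<in>M \<omega>. c (proc \<omega> l m))" if "l \<in> L \<omega>" for l
    using m0 c P that by (intro cINF_greatest) auto
  have up: "(INF m\<in>M \<omega>. c (proc \<omega> l m)) \<le> b" if "l \<in> L \<omega>" for l
    using m0 c P that by (intro cINF_lower2[OF _ m0]) (auto intro!: bdd_belowI[of _ a])
  show "a \<le> lower_value L M proc c \<omega>"
    unfolding lower_value_def using l0 low up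
    by (intro cSUP_upper2[OF _ l0]) (auto intro!: bdd_aboveI[of _ b])
  show "lower_value L M proc c \<omega> \<le> b"
    unfolding lower_value_def using l0 up by (intro cSUP_least) auto
qed

text \<open>The constant \<open>e\<close> passes through the infimum and then the supremum. Both
  live in the conditionally complete reals, so \<open>a\<close> is there to bound the inner infima
  from below and \<open>b\<close> to bound the outer supremum from above.\<close>

lemma lower_value_mono:
  assumes "\<omega> \<in> \<Omega>" and c: "\<And>z. z \<in> K \<Longrightarrow> a \<le> c z \<and> c z \<le> c' z + e"
    and c': "\<And>z. z \<in> K \<Longrightarrow> a \<le> c' z \<and> c' z \<le> b"
  shows "lower_value L M proc c \<omega> \<le> lower_value L M proc c' \<omega> + e"
proof -
  have P: "proc \<omega> l m \<in> K" if "l \<in> L \<omega>" "m \<in> M \<omega>" for l m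
    using proc_in_processes assms(1) that by blast
  obtain m0 where m0: "m0 \<in> M \<omega>"
    using M_nonempty assms(1) by blast
  have "(INF m\<in>M \<omega>. c (proc \<omega> l m)) \<le> lower_value L M proc c' \<omega> + e" if l: "l \<in> L \<omega>" for l
  proof -
    have "(INF m\<in>M \<omega>. c (proc \<omega> l m)) - e \<le> (INF m\<in>M \<omega>. c' (proc \<omega> l m))"
    proof (rule cINF_greatest)
      fix m assume m: "m \<in> M \<omega>"
      have "(INF m\<in>M \<omega>. c (proc \<omega> l m)) \<le> c (proc \<omega> l m)"
        using m c P l by (intro cINF_lower) (auto intro!: bdd_belowI[of _ a])
      then show "(INF m\<in>M \<omega>. c (proc \<omega> l m)) - e \<le> c' (proc \<omega> l m)"
        using c P[OF l m] by fastforce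
    qed (use m0 in auto)
    also have "\<dots> \<le> lower_value L M proc c' \<omega>"
      unfolding lower_value_def
    proof (rule cSUP_upper[OF l])
      have "(INF m\<in>M \<omega>. c' (proc \<omega> l m)) \<le> b" if "l \<in> L \<omega>" for l
        using m0 c' P that by (intro cINF_lower2[OF _ m0]) (auto intro!: bdd_belowI[of _ a])
      then show "bdd_above ((\<lambda>l. INF m\<in>M \<omega>. c' (proc \<omega> l m)) ` L \<omega>)"
        by (auto intro!: bdd_aboveI[of _ b])
    qed
    finally show ?thesis by simp
  qed
  then show ?thesis
    unfolding lower_value_def[of _ _ _ c] using L_nonempty assms(1) by (intro cSUP_least) auto
qed

text \<open>Monotonicity used both ways. This nonexpansiveness in the sup norm is what turns the
  continuation weight \<open>1 - \<delta>\<close> into a contraction factor later.\<close>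

lemma lower_value_diff:
  assumes "\<omega> \<in> \<Omega>" and "\<And>z. z \<in> K \<Longrightarrow> a \<le> c z \<and> c z \<le> b"
    and "\<And>z. z \<in> K \<Longrightarrow> a \<le> c' z \<and> c' z \<le> b"
    and "\<And>z. z \<in> K \<Longrightarrow> \<bar>c z - c' z\<bar> \<le> e"
  shows "\<bar>lower_value L M proc c \<omega> - lower_value L M proc c' \<omega>\<bar> \<le> e"
proof -
  have "lower_value L M proc c \<omega> \<le> lower_value L M proc c' \<omega> + e"
    using assms by (intro lower_value_mono[where a = a and b = b]) (auto simp: abs_le_iff algebra_simps)
  moreover have "lower_value L M proc c' \<omega> \<le> lower_value L M proc c \<omega> + e"
    using assms by (intro lower_value_mono[where a = a and b = b]) (auto simp: abs_le_iff algebra_simps)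
  ultimately show ?thesis by linarith
qed

section \<open>Integrals of the running cost and bounds on both values\<close>

lemma set_integrable_running_cost:
  assumes "z \<in> K" "S \<in> sets borel" "S \<subseteq> {0..}" "set_integrable lborel S f"
  shows "set_integrable lborel S (\<lambda>t. f t * g (z t))"
proof (rule set_integrable_bound[OF assms(4)])
  \<comment> \<open>Measurability of \<open>g (z t)\<close> is given only on \<open>{0..}\<close>,
    so both factors are extended by zero to the whole line; as \<open>S\<close> lies in
    \<open>{0..}\<close>, the two indicators multiply to that of \<open>S\<close>.\<close>
  have "(\<lambda>t. indicator {0..} t *\<^sub>R g (z t)) \<in> borel_measurable borel"
    using running_cost_measurable[OF assms(1)]
    by (subst (asm) borel_measurable_restrict_space_iff) auto
  moreover have "(\<lambda>t. indicator S t *\<^sub>R f t) \<in> borel_measurable borel"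
    using assms(4) unfolding set_integrable_def by auto
  ultimately have "(\<lambda>t. (indicator S t *\<^sub>R f t) * (indicator {0..} t *\<^sub>R g (z t))) \<in> borel_measurable borel"
    by measurable
  also have "(\<lambda>t. (indicator S t *\<^sub>R f t) * (indicator {0..} t *\<^sub>R g (z t))) =
      (\<lambda>t. indicator S t *\<^sub>R (f t * g (z t)))"
    using assms(3) by (auto simp: fun_eq_iff indicator_def)
  finally show "set_borel_measurable lborel S (\<lambda>t. f t * g (z t))"
    unfolding set_borel_measurable_def by simp
  show "AE t in lborel. t \<in> S \<longrightarrow> norm (f t * g (z t)) \<le> norm (f t)"
    using running_cost_bounds[OF assms(1)] assms(3)
    by (intro AE_I2 impI) (auto simp: abs_mult intro!: mult_left_le)
qed

text \<open>Integrates \<open>0 \<le> g \<le> 1\<close> for both payoffs at once: weight 1 on a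
  block for Cesaro, an exponential weight on the half-line for Abel.\<close>

lemma weighted_cost_bounds:
  assumes "z \<in> K" "S \<in> sets borel" "S \<subseteq> {0..}" "set_integrable lborel S f"
    and "\<And>t. t \<in> S \<Longrightarrow> 0 \<le> f t"
  shows "0 \<le> (LINT t:S|lborel. f t * g (z t))"
    and "(LINT t:S|lborel. f t * g (z t)) \<le> (LINT t:S|lborel. f t)"
proof -
  have g: "0 \<le> g (z t)" "g (z t) \<le> 1" if "t \<in> S" for t
    using running_cost_bounds[OF assms(1)] assms(3) that by auto
  show "0 \<le> (LINT t:S|lborel. f t * g (z t))"
    unfolding set_lebesgue_integral_def using g assms(5)
    by (intro Bochner_Integration.integral_nonneg) (auto simp: indicator_def)
  show "(LINT t:S|lborel. f t * g (z t)) \<le> (LINT t:S|lborel. f t)"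
    using g assms(5) set_integrable_running_cost[OF assms(1-4)] assms(4)
    by (intro set_integral_mono) (auto intro!: mult_left_le)
qed

lemma block_cost_bounds:
  assumes "z \<in> K" "h \<ge> 0"
  shows "0 \<le> (LINT t:{0..h}|lborel. g (z t))" "(LINT t:{0..h}|lborel. g (z t)) \<le> h"
  using weighted_cost_bounds[OF assms(1), of "{0..h}" "\<lambda>_. 1"] assms(2)
  by (auto simp: set_integrable_def set_lebesgue_integral_def)

lemma cesaro_value_bounds:
  assumes "\<omega> \<in> \<Omega>" "T > 0"
  shows "0 \<le> cesaro_value g L M proc T \<omega>" "cesaro_value g L M proc T \<omega> \<le> 1"
proof -
  have "0 \<le> cesaro_payoff g T z \<and> cesaro_payoff g T z \<le> 1" if "z \<in> K" for z
    using block_cost_bounds[OF that, of T] assms(2) by (simp add: cesaro_payoff_def)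
  from lower_value_bounds[OF assms(1) this]
  show "0 \<le> cesaro_value g L M proc T \<omega>" "cesaro_value g L M proc T \<omega> \<le> 1"
    unfolding cesaro_value_def by auto
qed

lemma abel_value_bounds:
  assumes "\<omega> \<in> \<Omega>" "r > 0"
  shows "0 \<le> abel_value g L M proc r \<omega>" "abel_value g L M proc r \<omega> \<le> 1"
proof -
  \<comment> \<open>Integrability is carried over from the gauge integral, with nonnegativity giving
    the absolute version. The mass \<open>1 / r\<close> found below makes the Abel payoff an
    average.\<close>
  have "(\<lambda>t. exp (- r * t)) absolutely_integrable_on {0..}"
    using integrable_on_exp_minus_to_infinity[OF assms(2), of 0]
    by (intro nonnegative_absolutely_integrable_1) auto
  then have int: "set_integrable lborel {0..} (\<lambda>t. exp (- r * t))"
    unfolding set_integrable_def by (subst (asm) integrable_completion) auto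
  have "(LINT t:{0..}|lborel. exp (- r * t)) = 1 / r"
    using has_integral_exp_minus_to_infinity[OF assms(2), of 0]
    by (subst set_borel_integral_eq_integral(2)[OF int]) (simp add: integral_unique)
  then have "0 \<le> abel_payoff g r z \<and> abel_payoff g r z \<le> 1" if "z \<in> K" for z
    using weighted_cost_bounds[OF that _ _ int] assms(2) mult_left_mono[of _ "1 / r" r]
    by (simp add: abel_payoff_def)
  from lower_value_bounds[OF assms(1) this]
  show "0 \<le> abel_value g L M proc r \<omega>" "abel_value g L M proc r \<omega> \<le> 1"
    unfolding abel_value_def by auto
qed

section \<open>An approximate dynamic programming principle shared by both families\<close>

definition block_payoff :: "real \<Rightarrow> real \<Rightarrow> ('w \<Rightarrow> real) \<Rightarrow> (real \<Rightarrow> 'w) \<Rightarrow> real" where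
  "block_payoff \<delta> T f z =
    1 / T * (LINT t:{0..\<delta> * T}|lborel. g (z t)) + (1 - \<delta>) * f (z (\<delta> * T))"

text \<open>The continuation horizon \<open>S\<close> is left open because the two families choose
  it differently; its lower bound makes \<open>S\<close> tend to infinity with \<open>T\<close> for
  fixed \<open>\<delta>\<close>.\<close>

definition approx_DPP :: "(real \<Rightarrow> 'w \<Rightarrow> real) \<Rightarrow> bool" where
  "approx_DPP A \<longleftrightarrow>
    (\<forall>T>0. \<forall>\<omega>\<in>\<Omega>. 0 \<le> A T \<omega> \<and> A T \<omega> \<le> 1) \<and>
    (\<forall>T>0. \<forall>\<delta>\<in>{0<..<1}. \<exists>S\<ge>(1 - \<delta>) * T. \<forall>\<omega>\<in>\<Omega>.
      \<bar>A T \<omega> - lower_value L M proc (block_payoff \<delta> T (A S)) \<omega>\<bar> \<le> \<delta>\<^sup>2)"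

lemma block_payoff_bounds:
  assumes "z \<in> K" "T > 0" "0 < \<delta>" "\<delta> < 1" "\<And>\<omega>. \<omega> \<in> \<Omega> \<Longrightarrow> 0 \<le> f \<omega> \<and> f \<omega> \<le> 1"
  shows "0 \<le> block_payoff \<delta> T f z \<and> block_payoff \<delta> T f z \<le> 1"
proof -
  have "0 \<le> 1 / T * (LINT t:{0..\<delta> * T}|lborel. g (z t))"
    "1 / T * (LINT t:{0..\<delta> * T}|lborel. g (z t)) \<le> \<delta>"
    using block_cost_bounds[OF assms(1), of "\<delta> * T"] assms(2,3) by (auto simp: field_simps)
  moreover have "0 \<le> (1 - \<delta>) * f (z (\<delta> * T))" "(1 - \<delta>) * f (z (\<delta> * T)) \<le> 1 - \<delta>"
    using assms(5)[OF process_state[OF assms(1), of "\<delta> * T"]] assms(2-4)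
    by (auto intro: mult_left_le)
  ultimately show ?thesis
    unfolding block_payoff_def by linarith
qed

text \<open>For \<open>h = \<delta> * T\<close> the weight \<open>(T - h) / T\<close> is
  \<open>1 - \<delta>\<close>, so the Cesaro principle is the block equation with no error at
  all.\<close>

lemma approx_DPP_cesaro:
  assumes "cesaro_DPP \<Omega> g L M proc"
  shows "approx_DPP (cesaro_value g L M proc)"
  unfolding approx_DPP_def
proof (intro conjI allI impI ballI)
  fix T \<delta> :: real assume T: "T > 0" and \<delta>: "\<delta> \<in> {0<..<1}"
  let ?S = "T - \<delta> * T"
  have h: "\<delta> * T \<in> {0<..<T}" "?S / T = 1 - \<delta>"
    using T \<delta> by (auto simp: field_simps)
  have "cesaro_value g L M proc T \<omega> =
      lower_value L M proc (block_payoff \<delta> T (cesaro_value g L M proc ?S)) \<omega>" if "\<omega> \<in> \<Omega>" for \<omega>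
    using assms[unfolded cesaro_DPP_def, rule_format, OF T h(1) that]
    unfolding block_payoff_def h(2) .
  then show "\<exists>S\<ge>(1 - \<delta>) * T. \<forall>\<omega>\<in>\<Omega>. \<bar>cesaro_value g L M proc T \<omega> -
      lower_value L M proc (block_payoff \<delta> T (cesaro_value g L M proc S)) \<omega>\<bar> \<le> \<delta>\<^sup>2"
    by (intro exI[of _ ?S]) (simp add: left_diff_distrib)
qed (use cesaro_value_bounds in auto)

text \<open>On the block the discount factor lies between \<open>exp (- r * h)\<close> and 1, and
  \<open>g\<close> is nonnegative.\<close>

lemma discounted_block_cost_bounds:
  assumes "z \<in> K" "h > 0" "r > 0"
  shows "exp (- r * h) * (LINT t:{0..h}|lborel. g (z t))
      \<le> (LINT t:{0..h}|lborel. exp (- r * t) * g (z t))"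
    and "(LINT t:{0..h}|lborel. exp (- r * t) * g (z t)) \<le> (LINT t:{0..h}|lborel. g (z t))"
proof -
  have int: "set_integrable lborel {0..h} (\<lambda>t. f t * g (z t))"
    if "continuous_on {0..h} f" for f :: "real \<Rightarrow> real"
    using assms that borel_integrable_atLeastAtMost'[of 0 h f]
    by (intro set_integrable_running_cost) auto
  have I: "set_integrable lborel {0..h} (\<lambda>t. exp (- r * t) * g (z t))"
    "set_integrable lborel {0..h} (\<lambda>t. exp (- r * h) * g (z t))"
    "set_integrable lborel {0..h} (\<lambda>t. g (z t))"
    using int[of "\<lambda>t. exp (- r * t)"] int[of "\<lambda>t. exp (- r * h)"] int[of "\<lambda>t. 1"]
      continuous_on_exp[OF continuous_on_mult_left[OF continuous_on_id, of "{0..h}" "- r"]]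
    by simp_all
  show "exp (- r * h) * (LINT t:{0..h}|lborel. g (z t))
      \<le> (LINT t:{0..h}|lborel. exp (- r * t) * g (z t))"
    unfolding set_integral_mult_right[symmetric]
    using running_cost_bounds[OF assms(1)] assms(2,3)
    by (intro set_integral_mono I mult_right_mono) auto
  show "(LINT t:{0..h}|lborel. exp (- r * t) * g (z t)) \<le> (LINT t:{0..h}|lborel. g (z t))"
    using running_cost_bounds[OF assms(1)] assms(2,3)
    by (intro set_integral_mono I) (auto intro!: mult_left_le_one_le)
qed

text \<open>With \<open>r = inverse T\<close> and \<open>h = \<delta> * T\<close> the discount over
  a block is \<open>exp (-\<delta>)\<close> for every \<open>T\<close>. Dropping the discount inside
  the block and replacing \<open>exp (-\<delta>)\<close> by \<open>1 - \<delta>\<close> are both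
  second-order changes; the continuation horizon stays \<open>T\<close>.\<close>

lemma approx_DPP_abel:
  assumes "abel_DPP \<Omega> g L M proc"
  shows "approx_DPP (\<lambda>T. abel_value g L M proc (inverse T))"
  unfolding approx_DPP_def
proof (intro conjI allI impI ballI)
  fix T \<delta> :: real assume T: "T > 0" and "\<delta> \<in> {0<..<1}"
  then have \<delta>: "0 < \<delta>" "\<delta> < 1" by auto
  define r h where "r = inverse T" and "h = \<delta> * T"
  have rh: "r > 0" "h > 0" "r * h = \<delta>" "1 / T = r"
    using T \<delta> by (auto simp: r_def h_def field_simps)
  let ?W = "abel_value g L M proc r"
  let ?c = "\<lambda>z. r * (LINT t:{0..h}|lborel. exp (- r * t) * g (z t)) + exp (- r * h) * ?W (z h)"
  have "exp (-\<delta>) \<le> 1 / (1 + \<delta>)"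
    using exp_ge_add_one_self[of \<delta>] \<delta> by (simp add: exp_minus field_simps)
  \<comment> \<open>Multiplied by \<open>1 + \<delta>\<close>, the right side becomes
    \<open>1 + \<delta>^3\<close>.\<close>
  also have "\<dots> \<le> 1 - \<delta> + \<delta>\<^sup>2"
    using \<delta> by (simp add: field_simps power2_eq_square power3_eq_cube)
  finally have exp_le: "exp (-\<delta>) \<le> 1 - \<delta> + \<delta>\<^sup>2" .
  have exp_ge: "1 - \<delta> \<le> exp (-\<delta>)"
    using exp_ge_add_one_self[of "-\<delta>"] by simp
  have c: "(0 \<le> ?c z \<and> ?c z \<le> 2) \<and> \<bar>?c z - block_payoff \<delta> T ?W z\<bar> \<le> \<delta>\<^sup>2" if z: "z \<in> K" for z
  proof -
    let ?I = "r * (LINT t:{0..h}|lborel. g (z t))"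
    let ?J = "r * (LINT t:{0..h}|lborel. exp (- r * t) * g (z t))"
    have "(LINT t:{0..h}|lborel. g (z t)) \<le> h" "0 \<le> (LINT t:{0..h}|lborel. g (z t))"
      using block_cost_bounds[OF z, of h] rh by auto
    then have I: "0 \<le> ?I" "?I \<le> \<delta>"
      using rh mult_left_mono[of _ h r] by auto
    have J: "?J \<le> ?I" "exp (-\<delta>) * ?I \<le> ?J"
      using discounted_block_cost_bounds[OF z rh(2,1)] rh by (auto simp: mult.left_commute)
    \<comment> \<open>Discounting removes at most a fraction \<open>\<delta>\<close> of a block cost
      that is itself at most \<open>\<delta>\<close>.\<close>
    have "(1 - exp (-\<delta>)) * ?I \<le> \<delta> * \<delta>"
      using I exp_ge \<delta> by (intro mult_mono) auto
    then have IJ: "?I - ?J \<le> \<delta>\<^sup>2"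
      using J by (simp add: power2_eq_square algebra_simps)
    have W: "0 \<le> ?W (z h)" "?W (z h) \<le> 1"
      using abel_value_bounds process_state[OF z] rh by auto
    have "0 \<le> (exp (-\<delta>) - (1 - \<delta>)) * ?W (z h)"
      using W exp_ge by simp
    moreover have "(exp (-\<delta>) - (1 - \<delta>)) * ?W (z h) \<le> \<delta>\<^sup>2"
      using W exp_ge exp_le mult_left_le[of "?W (z h)" "exp (-\<delta>) - (1 - \<delta>)"] by simp
    moreover have "block_payoff \<delta> T ?W z = ?I + (1 - \<delta>) * ?W (z h)"
      unfolding block_payoff_def h_def[symmetric] using rh by simp
    then have "?c z - block_payoff \<delta> T ?W z = (?J - ?I) + (exp (-\<delta>) - (1 - \<delta>)) * ?W (z h)"
      using rh by (simp add: left_diff_distrib)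
    \<comment> \<open>The two errors have opposite signs, so together they stay within
      \<open>\<delta>^2\<close> instead of adding up.\<close>
    ultimately have "\<bar>?c z - block_payoff \<delta> T ?W z\<bar> \<le> \<delta>\<^sup>2"
      using J(1) IJ by linarith
    moreover have "0 \<le> exp (-\<delta>) * ?W (z h)" "exp (-\<delta>) * ?W (z h) \<le> 1"
      using W \<delta> by (auto intro!: mult_le_one)
    moreover have "0 \<le> ?J"
      using J(2) I(1) by (meson exp_ge_zero mult_nonneg_nonneg order_trans)
    moreover have "exp (- r * h) = exp (-\<delta>)"
      using rh by simp
    ultimately show ?thesis
      using I(2) J(1) \<delta>(2) by (intro conjI) simp_all
  qed
  have "\<bar>?W \<omega> - lower_value L M proc (block_payoff \<delta> T ?W) \<omega>\<bar> \<le> \<delta>\<^sup>2" if \<omega>: "\<omega> \<in> \<Omega>" for \<omega>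
  proof -
    have "?W \<omega> = lower_value L M proc ?c \<omega>"
      by (rule assms[unfolded abel_DPP_def, rule_format, OF rh(1,2) \<omega>])
    moreover have "\<bar>lower_value L M proc ?c \<omega> - lower_value L M proc (block_payoff \<delta> T ?W) \<omega>\<bar> \<le> \<delta>\<^sup>2"
    proof (rule lower_value_diff[OF \<omega>, where a = 0 and b = 2])
      fix z assume z: "z \<in> K"
      show "0 \<le> ?c z \<and> ?c z \<le> 2" "\<bar>?c z - block_payoff \<delta> T ?W z\<bar> \<le> \<delta>\<^sup>2"
        using c[OF z] by blast+
      show "0 \<le> block_payoff \<delta> T ?W z \<and> block_payoff \<delta> T ?W z \<le> 2"
        using block_payoff_bounds[OF z T \<delta>, of ?W] abel_value_bounds rh(1) by fastforce
    qed
    ultimately show ?thesis by (simp only:)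
  qed
  moreover have "T \<ge> (1 - \<delta>) * T"
    using T \<delta> by simp
  ultimately show "\<exists>S\<ge>(1 - \<delta>) * T. \<forall>\<omega>\<in>\<Omega>. \<bar>abel_value g L M proc (inverse T) \<omega> -
      lower_value L M proc (block_payoff \<delta> T (abel_value g L M proc (inverse S))) \<omega>\<bar> \<le> \<delta>\<^sup>2"
    unfolding r_def by blast
qed (use abel_value_bounds in auto)

section \<open>Contraction of the distance and transfer of uniform limits\<close>

text \<open>Passing to the infimum \<open>\<beta>\<close> of all eventual bounds replaces an
  iteration of \<open>step\<close>, whose threshold in \<open>T\<close> may vary with
  \<open>b\<close> and \<open>\<delta>\<close>: from
  \<open>\<beta> \<le> (1 - \<delta>) * \<beta> + C * \<delta>^2\<close> follows
  \<open>\<beta> \<le> C * \<delta>\<close>.\<close>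

lemma uniformly_small_contraction:
  fixes d :: "real \<Rightarrow> 'x \<Rightarrow> real"
  assumes bounded: "\<forall>\<^sub>F T in at_top. \<forall>x\<in>X. \<bar>d T x\<bar> \<le> b0"
    and step: "\<And>\<delta> b. 0 < \<delta> \<Longrightarrow> \<delta> < 1 \<Longrightarrow> 0 \<le> b \<Longrightarrow> \<forall>\<^sub>F T in at_top. \<forall>x\<in>X. \<bar>d T x\<bar> \<le> b \<Longrightarrow>
      \<forall>\<^sub>F T in at_top. \<forall>x\<in>X. \<bar>d T x\<bar> \<le> (1 - \<delta>) * b + C * \<delta>\<^sup>2"
    and "C > 0" "e > 0"
  shows "\<forall>\<^sub>F T in at_top. \<forall>x\<in>X. \<bar>d T x\<bar> < e"
proof -
  define B where "B = {b. 0 \<le> b \<and> (\<forall>\<^sub>F T in at_top. \<forall>x\<in>X. \<bar>d T x\<bar> \<le> b)}"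
  have bdd: "bdd_below B"
    unfolding B_def by (auto intro: bdd_belowI[of _ 0])
  have "max 0 b0 \<in> B"
    unfolding B_def using bounded by (auto elim!: eventually_mono)
  then have ne: "B \<noteq> {}" by auto
  have "Inf B \<le> C * \<delta>" if \<delta>: "0 < \<delta>" "\<delta> < 1" for \<delta>
  proof -
    \<comment> \<open>The inequality \<open>Inf B \<le> (1 - \<delta>) * b + C * \<delta>^2\<close>
      is solved for \<open>b\<close>, so that its left side is a lower bound of
      \<open>B\<close>.\<close>
    have "(Inf B - C * \<delta>\<^sup>2) / (1 - \<delta>) \<le> b" if "b \<in> B" for b
    proof -
      have "0 \<le> (1 - \<delta>) * b + C * \<delta>\<^sup>2"
        using that \<delta> \<open>C > 0\<close> by (auto simp: B_def)
      then have "(1 - \<delta>) * b + C * \<delta>\<^sup>2 \<in> B"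
        using that step[OF \<delta>, of b] by (auto simp: B_def)
      then show ?thesis
        using cInf_lower[OF _ bdd] \<delta> by (fastforce simp: field_simps)
    qed
    then have "(Inf B - C * \<delta>\<^sup>2) / (1 - \<delta>) \<le> Inf B"
      using ne by (intro cInf_greatest) auto
    then have "\<delta> * Inf B \<le> \<delta> * (C * \<delta>)"
      using \<delta> by (simp add: field_simps power2_eq_square)
    then show ?thesis using \<delta> by simp
  qed
  \<comment> \<open>The entry \<open>1/2\<close> keeps \<open>\<delta> < 1\<close>; the other gives
    \<open>C * \<delta> \<le> e / 2\<close>.\<close>
  from this[of "min (1/2) (e / (2 * C))"] have "Inf B \<le> C * min (1/2) (e / (2 * C))"
    using \<open>e > 0\<close> \<open>C > 0\<close> by auto
  also have "\<dots> \<le> C * (e / (2 * C))"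
    using \<open>C > 0\<close> by (intro mult_left_mono) auto
  also have "\<dots> < e"
    using \<open>C > 0\<close> \<open>e > 0\<close> by simp
  finally obtain b where "b \<in> B" "b < e"
    using cInf_lessD[OF ne] by blast
  then show ?thesis
    unfolding B_def by (auto elim!: eventually_mono)
qed

text \<open>Convergence of \<open>A\<close> alone makes a change of continuation horizon cheap, so
  the distance to \<open>B\<close> contracts. The roles of \<open>A\<close> and \<open>B\<close> can
  be exchanged, which yields both directions of the equivalence.\<close>

lemma approx_DPP_uniform_limit:
  assumes A: "approx_DPP A" and B: "approx_DPP B" and lim: "uniform_limit \<Omega> A f at_top"
  shows "uniform_limit \<Omega> B f at_top"
proof -
  have bounds: "0 \<le> A T \<omega>" "A T \<omega> \<le> 1" "0 \<le> B T \<omega>" "B T \<omega> \<le> 1" if "T > 0" "\<omega> \<in> \<Omega>" for T \<omega>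
    using A B that unfolding approx_DPP_def by auto
  have "\<forall>\<^sub>F T in at_top. \<forall>\<omega>\<in>\<Omega>. \<bar>A T \<omega> - B T \<omega>\<bar> < e" if "e > 0" for e
  \<comment> \<open>Of the three errors \<open>\<delta>^2\<close>, two come from
    \<open>approx_DPP\<close> for \<open>A\<close> and \<open>B\<close> and one from the change of
    horizon; the initial bound 1 holds as both values lie between 0 and 1.\<close>
  proof (rule uniformly_small_contraction[where C = 3 and ?b0.0 = 1])
    show "\<forall>\<^sub>F T in at_top. \<forall>\<omega>\<in>\<Omega>. \<bar>A T \<omega> - B T \<omega>\<bar> \<le> 1"
      using eventually_gt_at_top[of 0]
      by eventually_elim (auto simp: abs_le_iff, (smt (verit) bounds)+)
  next
    fix \<delta> b :: real
    assume \<delta>: "0 < \<delta>" "\<delta> < 1" and b: "0 \<le> b" "\<forall>\<^sub>F T in at_top. \<forall>\<omega>\<in>\<Omega>. \<bar>A T \<omega> - B T \<omega>\<bar> \<le> b"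
    \<comment> \<open>Half of \<open>\<delta>^2\<close>, since two horizons of \<open>A\<close> are
      compared through \<open>f\<close>.\<close>
    have "\<forall>\<^sub>F T in at_top. \<forall>\<omega>\<in>\<Omega>. \<bar>A T \<omega> - f \<omega>\<bar> < \<delta>\<^sup>2 / 2"
      using uniform_limitD[OF lim, of "\<delta>\<^sup>2 / 2"] \<delta> by (simp add: dist_real_def)
    then have "\<forall>\<^sub>F T in at_top. \<forall>\<omega>\<in>\<Omega>. \<bar>A T \<omega> - B T \<omega>\<bar> \<le> b \<and> \<bar>A T \<omega> - f \<omega>\<bar> < \<delta>\<^sup>2 / 2"
      using b(2) by eventually_elim auto
    then obtain T0 where T0: "\<bar>A T \<omega> - B T \<omega>\<bar> \<le> b" "\<bar>A T \<omega> - f \<omega>\<bar> < \<delta>\<^sup>2 / 2"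
      if "T \<ge> T0" "\<omega> \<in> \<Omega>" for T \<omega>
      unfolding eventually_at_top_linorder by blast
    show "\<forall>\<^sub>F T in at_top. \<forall>\<omega>\<in>\<Omega>. \<bar>A T \<omega> - B T \<omega>\<bar> \<le> (1 - \<delta>) * b + 3 * \<delta>\<^sup>2"
      \<comment> \<open>Beyond this threshold every continuation horizon is at least
        \<open>T0\<close>.\<close>
      using eventually_ge_at_top[of "T0 / (1 - \<delta>)"] eventually_gt_at_top[of 0]
    proof (eventually_elim, intro ballI)
      fix T \<omega> assume "T \<ge> T0 / (1 - \<delta>)" and T: "T > 0" and \<omega>: "\<omega> \<in> \<Omega>"
      then have T_ge: "(1 - \<delta>) * T \<ge> T0"
        using \<delta> by (simp add: field_simps)
      obtain S where S: "S \<ge> (1 - \<delta>) * T"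
        "\<bar>A T \<omega> - lower_value L M proc (block_payoff \<delta> T (A S)) \<omega>\<bar> \<le> \<delta>\<^sup>2"
        using A T \<delta> \<omega> unfolding approx_DPP_def by (metis greaterThanLessThan_iff)
      obtain R where R: "R \<ge> (1 - \<delta>) * T"
        "\<bar>B T \<omega> - lower_value L M proc (block_payoff \<delta> T (B R)) \<omega>\<bar> \<le> \<delta>\<^sup>2"
        using B T \<delta> \<omega> unfolding approx_DPP_def by (metis greaterThanLessThan_iff)
      have "0 < (1 - \<delta>) * T" using T \<delta> by simp
      then have pos: "S > 0" "R > 0" using S(1) R(1) by linarith+
      have "\<bar>lower_value L M proc (block_payoff \<delta> T (A S)) \<omega> -
          lower_value L M proc (block_payoff \<delta> T (B R)) \<omega>\<bar> \<le> (1 - \<delta>) * (b + \<delta>\<^sup>2)"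
      proof (rule lower_value_diff[OF \<omega>, where a = 0 and b = 1])
        fix z assume z: "z \<in> K"
        show "0 \<le> block_payoff \<delta> T (A S) z \<and> block_payoff \<delta> T (A S) z \<le> 1"
          "0 \<le> block_payoff \<delta> T (B R) z \<and> block_payoff \<delta> T (B R) z \<le> 1"
          using bounds pos by (auto intro!: block_payoff_bounds[OF z T \<delta>])
        have zh: "z (\<delta> * T) \<in> \<Omega>"
          using process_state[OF z] T \<delta> by simp
        \<comment> \<open>The path is \<open>A S\<close>, \<open>f\<close>, \<open>A R\<close>,
          \<open>B R\<close>: moving from \<open>S\<close> to \<open>R\<close> costs
          \<open>\<delta>^2\<close>, and \<open>b\<close> compares the families at the common
          horizon \<open>R\<close>.\<close>
        have "\<bar>A S (z (\<delta> * T)) - B R (z (\<delta> * T))\<bar> \<le> b + \<delta>\<^sup>2"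
          using T0(2)[of S, OF _ zh] T0[of R, OF _ zh] S(1) R(1) T_ge by linarith
        then have "(1 - \<delta>) * \<bar>A S (z (\<delta> * T)) - B R (z (\<delta> * T))\<bar> \<le> (1 - \<delta>) * (b + \<delta>\<^sup>2)"
          using \<delta> by (intro mult_left_mono) auto
        \<comment> \<open>The running costs over the common block cancel.\<close>
        then show "\<bar>block_payoff \<delta> T (A S) z - block_payoff \<delta> T (B R) z\<bar> \<le> (1 - \<delta>) * (b + \<delta>\<^sup>2)"
          using \<delta> by (simp add: block_payoff_def abs_mult flip: right_diff_distrib)
      qed
      moreover have "(1 - \<delta>) * (b + \<delta>\<^sup>2) \<le> (1 - \<delta>) * b + \<delta>\<^sup>2"
        using \<delta> by (simp add: algebra_simps)
      ultimately show "\<bar>A T \<omega> - B T \<omega>\<bar> \<le> (1 - \<delta>) * b + 3 * \<delta>\<^sup>2"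
        using S(2) R(2) by linarith
    qed
  qed (use that in auto)
  then have "uniform_limit \<Omega> (\<lambda>T \<omega>. A T \<omega> - B T \<omega>) (\<lambda>_. 0) at_top"
    by (intro uniform_limitI) (simp add: dist_real_def)
  from uniform_limit_minus[OF lim this] show ?thesis by simp
qed

end

theorem theorem1:
  fixes \<Omega> :: "'w set"
    and K :: "(real \<Rightarrow> 'w) set"
    and g :: "'w \<Rightarrow> real"
    and L :: "'w \<Rightarrow> 'l set"
    and M :: "'w \<Rightarrow> 'm set"
    and proc :: "'w \<Rightarrow> 'l \<Rightarrow> 'm \<Rightarrow> real \<Rightarrow> 'w"
  assumes "dynamic_game \<Omega> K g L M proc"
    and "cesaro_DPP \<Omega> g L M proc"
    and "abel_DPP \<Omega> g L M proc"
  shows "((\<exists>f. uniform_limit \<Omega> (cesaro_value g L M proc) f at_top) \<longleftrightarrow>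
          (\<exists>f. uniform_limit \<Omega> (abel_value g L M proc) f (at_right 0))) \<and>
         ((\<exists>f. uniform_limit \<Omega> (cesaro_value g L M proc) f at_top) \<or>
          (\<exists>f. uniform_limit \<Omega> (abel_value g L M proc) f (at_right 0)) \<longrightarrow>
          (\<forall>\<omega>\<in>\<Omega>. \<exists>v.
            ((\<lambda>T. cesaro_value g L M proc T \<omega>) \<longlongrightarrow> v) at_top \<and>
            ((\<lambda>r. abel_value g L M proc r \<omega>) \<longlongrightarrow> v) (at_right 0)))"
proof -
  interpret dynamic_game \<Omega> K g L M proc by fact
  \<comment> \<open>Keeping the same \<open>f\<close> on both sides gives equality of the limits
    along with the equivalence.\<close>
  have "uniform_limit \<Omega> (cesaro_value g L M proc) f at_top \<longleftrightarrow>
      uniform_limit \<Omega> (abel_value g L M proc) f (at_right 0)" for f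
    \<comment> \<open>Substitutes \<open>inverse T\<close> for the discount rate, the form in which
      \<open>approx_DPP_abel\<close> is stated.\<close>
    unfolding filterlim_at_right_to_top
    using approx_DPP_uniform_limit approx_DPP_cesaro[OF assms(2)] approx_DPP_abel[OF assms(3)]
    by blast
  moreover have "\<forall>\<omega>\<in>\<Omega>. \<exists>v. ((\<lambda>T. cesaro_value g L M proc T \<omega>) \<longlongrightarrow> v) at_top \<and>
      ((\<lambda>r. abel_value g L M proc r \<omega>) \<longlongrightarrow> v) (at_right 0)"
    if "uniform_limit \<Omega> (cesaro_value g L M proc) f at_top"
      and "uniform_limit \<Omega> (abel_value g L M proc) f (at_right 0)" for f
    using that by (auto intro!: exI[of _ "f _"] tendsto_uniform_limitI[where S = \<Omega>])
  ultimately show ?thesis by metis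
qed

end
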